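(* Let $T=(F_i)_{1\le i\le 4}$ be a very generic tetrahedron of flags in $\mathbb{CP}^2$ with edge coordinates $z_{ij}$ and face coordinates $z_{ijk}$. Let $T^*$ be its dual configuration, with edge coordinates $z^*_{ij}$ and face coordinates $z^*_{ijk}$. Then: (1) For the face coordinates, $z^*_{ijk}=\dfrac{1}{z_{ijk}}$. (2) For the edge coordinates: given $i\neq j$, choose $k,l$ such that the permutation $(1,2,3,4)\mapsto(i,j,k,l)$ is even. Then $$z^*_{ij}=z_{ji}\,\frac{1-z_{ik}z_{jk}z_{lk}}{1-\frac{1}{z_{il}z_{jl}z_{kl}}}=z_{ji}\,\frac{1+z_{jil}}{1+\frac{1}{z_{ijk}}}.$$
   Context: Let $V=\mathbb{C}^3$ with its standard basis. A flag of $\mathbb{P}(V)=\mathbb{CP}^2$ is a pair $([x],[f])\in\mathbb{P}(V)\times\mathbb{P}(V^* )$ with $f(x)=0$ (the point $[x]$ on the line $\ker f$). The group $\mathrm{PGL}(3,\mathbb{C})$ acts on flags by $A([x],[f])=([Ax],[f\circ A^{-1}])$. Configurations of $m$ ordered flags are the $\mathrm{PGL}(3,\mathbb{C})$-orbits of $m$-tuples of flags. A configuration $([x_i],[f_i])_{1\le i\le m}$ is generic if $f_i(x_j)\neq 0$ for all $i\neq j$ and no three of the points $[x_i]$ are collinear. It is very generic if in addition no three of the lines $\ker f_i$ pass through a common point. A (very) generic tetrahedron of flags is a (very) generic configuration $T=([x_i],[f_i])_{1\le i\le 4}$ of four ordered flags. The dual of $F=([x],[f])$ is $F^*=([f],[x])$,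 viewed as a flag of $\mathbb{P}(V)$ by identifying $V^*$ with $V$ through the dual of the standard basis (and $V^{**}=V$). The dual configuration of $T=(F_i)$ is $T^*=(F_i^* )$; it is very generic when $T$ is. Cross-ratio: $X(a,b,c,d)=\frac{(a-c)(b-d)}{(a-d)(b-c)}$ for four distinct points of a projective line. Edge coordinates of a generic tetrahedron of flags $T$: for $i\ne j$, let $k,l$ be such that $(1,2,3,4)\mapsto(i,j,k,l)$ is an even permutation. Then $z_{ij}(T)=X(\ker f_i,\,x_ix_j,\,x_ix_k,\,x_ix_l)$, the cross-ratio in the pencil of lines through $[x_i]$, where $x_ix_j$ is the line through $[x_i]$ and $[x_j]$. Equivalently, $z_{ij}(T)=\frac{f_i(x_k)\det(x_i,x_j,x_l)}{f_i(x_l)\det(x_i,x_j,x_k)}$. Face coordinates: $z_{ijk}(T)=\frac{f_i(x_j)f_j(x_k)f_k(x_i)}{f_i(x_k)f_j(x_i)f_k(x_j)}$ for distinct $i,j,k$. *)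

theory Defs
  imports "HOL-Analysis.Analysis"
begin

section \<open>The projective plane and its dual\<close>

definition proportional :: "complex ^ 3 \<Rightarrow> complex ^ 3 \<Rightarrow> bool" where
  "proportional x y \<longleftrightarrow> x \<noteq> 0 \<and> y \<noteq> 0 \<and> (\<exists>c. y = c *s x)"

lemma proportional_iff: "proportional x y \<longleftrightarrow> x \<noteq> 0 \<and> (\<exists>c. c \<noteq> 0 \<and> y = c *s x)"
  unfolding proportional_def by (metis vec.scale_eq_0_iff)

lemma proportional_refl: "x \<noteq> 0 \<Longrightarrow> proportional x x"
  unfolding proportional_iff by (metis one_neq_zero vec.scale_one)

lemma proportional_refl_iff: "proportional x x \<longleftrightarrow> x \<noteq> 0"
  using proportional_refl proportional_def by blast

lemma proportional_sym:
  assumes "proportional x y"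
  shows "proportional y x"
proof -
  obtain c where "c \<noteq> 0" "y = c *s x" using assms unfolding proportional_iff by blast
  then have "x = inverse c *s y" by (simp add: vector_smult_assoc)
  then show ?thesis using assms unfolding proportional_def by blast
qed

lemma proportional_trans: "proportional x y \<Longrightarrow> proportional y z \<Longrightarrow> proportional x z"
  unfolding proportional_def by (metis vec.scale_scale)

text \<open>
  A point of \<open>P(V)\<close> is the class of a nonzero vector. A covector \<open>f\<close> is written in the dual of the
  standard basis, with value \<open>scalar_product f x\<close> at \<open>x\<close>, so the same type also serves as
  \<open>P(V\<^sup>*)\<close>: its elements are then lines \<open>ker f\<close> of the plane. This is the identification of \<open>V\<^sup>*\<close>
  with \<open>V\<close> that the dual of a flag uses.
\<close>

quotient_type cp2 = "complex ^ 3" / partial: proportional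
proof (rule part_equivpI)
  have "proportional (axis 1 1) (axis 1 1)"
    by (rule proportional_refl) (simp add: axis_eq_0_iff)
  then show "\<exists>x. proportional x x" ..
  show "symp proportional" by (rule sympI) (rule proportional_sym)
  show "transp proportional" by (rule transpI) (rule proportional_trans)
qed

type_synonym dual_cp2 = cp2

lemma scalar_product_scale:
  "scalar_product (c *s f) (x :: complex ^ 'n) = c * scalar_product f x"
  "scalar_product f (c *s (x :: complex ^ 'n)) = c * scalar_product f x"
  by (simp_all add: scalar_product_def sum_distrib_left mult_ac)

lemma scalar_product_commute: "scalar_product f (x :: complex ^ 'n) = scalar_product x f"
  by (simp add: scalar_product_def mult.commute)

lift_definition incident :: "cp2 \<Rightarrow> dual_cp2 \<Rightarrow> bool" is "\<lambda>x f. scalar_product f x = 0"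
  by (auto simp: proportional_iff scalar_product_scale)

lemma incident_commute: "incident p l \<longleftrightarrow> incident l p"
  by transfer (simp add: scalar_product_commute)


section \<open>Cross-ratio\<close>

text \<open>
  For independent \<open>u\<close>, \<open>v\<close>, the map \<open>t \<mapsto> [t u + v]\<close> is an affine coordinate on the projective line
  through \<open>[u]\<close> and \<open>[v]\<close>, with \<open>[u]\<close> at infinity. Any four points of that line are at finite
  distance for some such coordinate, and the cross-ratio of four distinct points does not depend on
  it.
\<close>

lift_definition affine_coord :: "complex ^ 3 \<Rightarrow> complex ^ 3 \<Rightarrow> cp2 \<Rightarrow> complex \<Rightarrow> bool"
  is "\<lambda>u v p t. proportional p (t *s u + v)"
  by (metis proportional_sym proportional_trans)

definition lin_indep2 :: "complex ^ 3 \<Rightarrow> complex ^ 3 \<Rightarrow> bool" where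
  "lin_indep2 u v \<longleftrightarrow> (\<forall>s t. s *s u + t *s v = 0 \<longrightarrow> s = 0 \<and> t = 0)"

definition cross_ratio :: "cp2 \<Rightarrow> cp2 \<Rightarrow> cp2 \<Rightarrow> cp2 \<Rightarrow> complex" where
  "cross_ratio p\<^sub>1 p\<^sub>2 p\<^sub>3 p\<^sub>4 = (THE z. \<exists>u v a b c d. lin_indep2 u v \<and>
     affine_coord u v p\<^sub>1 a \<and> affine_coord u v p\<^sub>2 b \<and>
     affine_coord u v p\<^sub>3 c \<and> affine_coord u v p\<^sub>4 d \<and>
     z = ((a - c) * (b - d)) / ((a - d) * (b - c)))"


section \<open>Flags and the action of the projective linear group\<close>

typedef flag = "{(p :: cp2, l :: dual_cp2). incident p l}"
  morphisms flag_pair Flag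
proof -
  have "\<exists>(p :: cp2) l. incident p l"
  proof transfer
    show "\<exists>x\<in>Collect (\<lambda>x. proportional x x). \<exists>f\<in>Collect (\<lambda>x. proportional x x). scalar_product f x = 0"
      by (intro bexI[of _ "axis 1 1"] bexI[of _ "axis 2 1"])
         (auto simp: scalar_product_def axis_def sum_3 proportional_def vec_eq_iff intro!: exI[of _ 1])
  qed
  then show ?thesis by auto
qed

definition point_of :: "flag \<Rightarrow> cp2" where "point_of F = fst (flag_pair F)"

definition line_of :: "flag \<Rightarrow> dual_cp2" where "line_of F = snd (flag_pair F)"

definition dual_flag :: "flag \<Rightarrow> flag" where "dual_flag F = Flag (line_of F, point_of F)"

lemma incident_flag: "incident (point_of F) (line_of F)"
  using flag_pair[of F] by (auto simp: point_of_def line_of_def)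

lemma point_of_Flag: "incident p l \<Longrightarrow> point_of (Flag (p, l)) = p"
  and line_of_Flag: "incident p l \<Longrightarrow> line_of (Flag (p, l)) = l"
  by (simp_all add: point_of_def line_of_def Flag_inverse)

lemma flag_eqI: "point_of F = point_of G \<Longrightarrow> line_of F = line_of G \<Longrightarrow> F = G"
  by (metis point_of_def line_of_def flag_pair_inject prod.expand)

lemma point_of_dual [simp]: "point_of (dual_flag F) = line_of F"
  and line_of_dual [simp]: "line_of (dual_flag F) = point_of F"
  using incident_flag[of F]
  by (simp_all add: dual_flag_def point_of_Flag line_of_Flag incident_commute)

lemma matrix_inv:
  fixes A :: "complex ^ 3 ^ 3"
  assumes "invertible A"
  shows "A ** matrix_inv A = mat 1" "matrix_inv A ** A = mat 1"
  using assms unfolding invertible_def matrix_inv_def by (metis (mono_tags, lifting) someI_ex)+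

lemma matrix_inv_unique:
  fixes A B :: "complex ^ 3 ^ 3"
  assumes "A ** B = mat 1"
  shows "matrix_inv A = B"
proof -
  have "B ** A = mat 1" using assms matrix_left_right_inverse by blast
  then have "invertible A" using assms unfolding invertible_def by blast
  then have "matrix_inv A ** (A ** B) = B" by (simp add: matrix_mul_assoc matrix_inv)
  then show ?thesis using assms by simp
qed

lemma mat_vec: "mat c *v x = c *s (x :: complex ^ 3)"
  by (simp add: vec_eq_iff matrix_vector_mult_def mat_def if_distrib if_distribR cong: if_cong)

lemma vec_mat: "x v* mat c = c *s (x :: complex ^ 3)"
  by (simp add: vec_eq_iff vector_matrix_mult_def mat_def if_distrib if_distribR cong: if_cong)

lemma mat_mat: "mat c ** mat d = (mat (c * d) :: complex ^ 3 ^ 3)"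
  by (simp add: vec_eq_iff forall_3 matrix_matrix_mult_def mat_def sum_3)

definition pgl_rel :: "complex ^ 3 ^ 3 \<Rightarrow> complex ^ 3 ^ 3 \<Rightarrow> bool" where
  "pgl_rel A B \<longleftrightarrow> invertible A \<and> (\<exists>c. c \<noteq> 0 \<and> B = mat c ** A)"

lemma invertible_scale:
  fixes A :: "complex ^ 3 ^ 3"
  assumes "invertible A" "c \<noteq> 0"
  shows "A ** matrix_inv A = mat 1" and "(mat c ** A) ** (matrix_inv A ** mat (inverse c)) = mat 1"
    and "invertible (mat c ** A)"
    and "matrix_inv (mat c ** A) = matrix_inv A ** mat (inverse c)"
proof -
  show 1: "A ** matrix_inv A = mat 1" using assms matrix_inv by blast
  have "(mat c ** A) ** (matrix_inv A ** mat (inverse c)) = mat c ** (A ** matrix_inv A) ** mat (inverse c)"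
    by (simp add: matrix_mul_assoc)
  then show 2: "(mat c ** A) ** (matrix_inv A ** mat (inverse c)) = mat 1"
    using assms by (simp add: 1 mat_mat)
  show "invertible (mat c ** A)" using 2 invertible_right_inverse by blast
  show "matrix_inv (mat c ** A) = matrix_inv A ** mat (inverse c)"
    using 2 by (rule matrix_inv_unique)
qed

quotient_type pgl3 = "complex ^ 3 ^ 3" / partial: pgl_rel
proof (rule part_equivpI)
  show "\<exists>A. pgl_rel A A"
    unfolding pgl_rel_def by (intro exI[of _ "mat 1"] conjI exI[of _ 1]) (auto simp: invertible_def intro!: exI[of _ "mat 1"])
  show "symp pgl_rel"
  proof (rule sympI)
    fix A B assume "pgl_rel A B"
    then obtain c where c: "invertible A" "c \<noteq> 0" "B = mat c ** A" unfolding pgl_rel_def by blast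
    then have "A = mat (inverse c) ** B" by (simp add: matrix_mul_assoc mat_mat)
    then show "pgl_rel B A"
      using c invertible_scale(3)[of A c] unfolding pgl_rel_def by (auto intro!: exI[of _ "inverse c"])
  qed
  show "transp pgl_rel"
  proof (rule transpI)
    fix A B C assume "pgl_rel A B" "pgl_rel B C"
    then obtain c d where *: "invertible A" "c \<noteq> 0" "B = mat c ** A" "d \<noteq> 0" "C = mat d ** B"
      unfolding pgl_rel_def by blast
    then show "pgl_rel A C"
      unfolding pgl_rel_def by (auto simp: matrix_mul_assoc mat_mat intro!: exI[of _ "d * c"])
  qed
qed

lemma invertible_mult_nz:
  fixes A :: "complex ^ 3 ^ 3"
  assumes "invertible A"
  shows "A *v x = 0 \<longleftrightarrow> x = 0" "x v* A = 0 \<longleftrightarrow> x = 0"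
    "x v* matrix_inv A = 0 \<longleftrightarrow> x = 0"
proof -
  show "A *v x = 0 \<longleftrightarrow> x = 0"
    using matrix_vector_mul_assoc[of "matrix_inv A" A x] matrix_inv[OF assms] by auto
  show "x v* A = 0 \<longleftrightarrow> x = 0"
    using vector_matrix_mul_assoc[of x A "matrix_inv A"] matrix_inv[OF assms] by auto
  show "x v* matrix_inv A = 0 \<longleftrightarrow> x = 0"
    using vector_matrix_mul_assoc[of x "matrix_inv A" A] matrix_inv[OF assms] by auto
qed

text \<open>
  \<open>A\<close> sends \<open>[x]\<close> to \<open>[A x]\<close> and \<open>[f]\<close> to \<open>[f \<circ> A\<^sup>-\<^sup>1]\<close>; in dual coordinates \<open>f \<circ> A\<^sup>-\<^sup>1\<close> is the row vector
  \<open>f v* matrix_inv A\<close>.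
\<close>

lift_definition pgl_point :: "pgl3 \<Rightarrow> cp2 \<Rightarrow> cp2" is "\<lambda>A x. A *v x"
proof -
  fix A B x y assume "pgl_rel A B" "proportional x y"
  then obtain c d where *: "invertible A" "c \<noteq> 0" "B = mat c ** A" "x \<noteq> 0" "d \<noteq> 0" "y = d *s x"
    unfolding pgl_rel_def proportional_iff by blast
  have "B *v y = mat c *v (A *v (d *s x))"
    using * by (simp only: matrix_vector_mul_assoc)
  also have "\<dots> = (c * d) *s (A *v x)"
    by (simp only: mat_vec vector_scalar_commute vector_smult_assoc mult.commute)
  finally show "proportional (A *v x) (B *v y)"
    using * unfolding proportional_iff
    by (auto simp: invertible_mult_nz intro!: exI[of _ "c * d"])
qed

lift_definition pgl_line :: "pgl3 \<Rightarrow> dual_cp2 \<Rightarrow> dual_cp2" is "\<lambda>A f. f v* matrix_inv A"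
proof -
  fix A B x y assume "pgl_rel A B" "proportional x y"
  then obtain c d where *: "invertible A" "c \<noteq> 0" "B = mat c ** A" "x \<noteq> 0" "d \<noteq> 0" "y = d *s x"
    unfolding pgl_rel_def proportional_iff by blast
  have "y v* matrix_inv B = ((d *s x) v* matrix_inv A) v* mat (inverse c)"
    using * invertible_scale(4)[of A c] by (simp add: vector_matrix_mul_assoc)
  also have "\<dots> = (inverse c * d) *s (x v* matrix_inv A)"
    by (simp only: vec_mat scalar_vector_matrix_assoc vector_smult_assoc mult.commute)
  finally show "proportional (x v* matrix_inv A) (y v* matrix_inv B)"
    using * unfolding proportional_iff
    by (auto simp: invertible_mult_nz intro!: exI[of _ "inverse c * d"])
qed

lemma scalar_product_adjoint:
  "scalar_product (f v* (A :: complex ^ 3 ^ 3)) x = scalar_product f (A *v x)"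
  by (simp add: scalar_product_def vector_matrix_mult_def matrix_vector_mult_def sum_3 algebra_simps)

lemma scalar_product_pgl:
  fixes A :: "complex ^ 3 ^ 3"
  assumes "invertible A"
  shows "scalar_product (f v* matrix_inv A) (A *v x) = scalar_product f x"
  by (simp add: scalar_product_adjoint matrix_vector_mul_assoc matrix_inv[OF assms])

lemma incident_pgl: "incident (pgl_point g p) (pgl_line g l) \<longleftrightarrow> incident p l"
  by transfer (simp add: scalar_product_pgl pgl_rel_def)

definition pgl_flag :: "pgl3 \<Rightarrow> flag \<Rightarrow> flag" where
  "pgl_flag g F = Flag (pgl_point g (point_of F), pgl_line g (line_of F))"

lemma point_of_pgl [simp]: "point_of (pgl_flag g F) = pgl_point g (point_of F)"
  and line_of_pgl [simp]: "line_of (pgl_flag g F) = pgl_line g (line_of F)"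
  using incident_flag[of F]
  by (simp_all add: pgl_flag_def point_of_Flag line_of_Flag incident_pgl)

lemma pgl_id: "\<exists>g. (\<forall>p. pgl_point g p = p) \<and> (\<forall>l. pgl_line g l = l)"
proof transfer
  have "invertible (mat 1 :: complex ^ 3 ^ 3)" by (auto simp: invertible_def)
  moreover have "matrix_inv (mat 1 :: complex ^ 3 ^ 3) = mat 1" by (rule matrix_inv_unique) simp
  ultimately show "\<exists>A\<in>Collect (\<lambda>x. pgl_rel x x). (\<forall>p\<in>Collect (\<lambda>x. proportional x x). proportional (A *v p) p) \<and>
      (\<forall>l\<in>Collect (\<lambda>x. proportional x x). proportional (l v* matrix_inv A) l)"
    by (intro bexI[of _ "mat 1"]) (auto simp: pgl_rel_def intro!: exI[of _ 1])
qed

lemma pgl_rel_refl: "pgl_rel A A \<longleftrightarrow> invertible A"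
  by (auto simp: pgl_rel_def intro!: exI[of _ 1])

lemma pgl_inverse:
  "\<exists>h. (\<forall>p. pgl_point h (pgl_point g p) = p \<and> pgl_point g (pgl_point h p) = p) \<and>
    (\<forall>l. pgl_line h (pgl_line g l) = l \<and> pgl_line g (pgl_line h l) = l)"
proof (transfer, goal_cases)
  case (1 A)
  then have A: "invertible A" by (simp add: pgl_rel_refl)
  let ?B = "matrix_inv A"
  have B: "invertible ?B" "matrix_inv ?B = A"
    using matrix_inv[OF A] by (auto simp: invertible_def intro: matrix_inv_unique)
  show ?case
    by (rule bexI[of _ ?B])
       (auto simp: B pgl_rel_refl matrix_vector_mul_assoc vector_matrix_mul_assoc matrix_inv[OF A])
qed

lemma pgl_mult:
  "\<exists>k. (\<forall>p. pgl_point k p = pgl_point h (pgl_point g p)) \<and>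
    (\<forall>l. pgl_line k l = pgl_line h (pgl_line g l))"
proof (transfer, goal_cases)
  case (1 B A)
  then have A: "invertible A" and B: "invertible B" by (simp_all add: pgl_rel_refl)
  have BA: "invertible (B ** A)" using A B by (rule invertible_mult[rotated])
  have "(B ** A) ** (matrix_inv A ** matrix_inv B) = B ** (A ** matrix_inv A) ** matrix_inv B"
    by (simp add: matrix_mul_assoc)
  then have "matrix_inv (B ** A) = matrix_inv A ** matrix_inv B"
    using matrix_inv[OF A] matrix_inv[OF B] by (intro matrix_inv_unique) simp
  then have line: "l v* matrix_inv (B ** A) = (l v* matrix_inv A) v* matrix_inv B" for l
    by (simp add: vector_matrix_mul_assoc)
  show ?case using BA
    by (intro bexI[of _ "B ** A"])
       (simp_all add: A B pgl_rel_refl line proportional_refl_iff invertible_mult_nz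
         flip: matrix_vector_mul_assoc)
qed

section \<open>Configurations of flags\<close>

definition config_rel :: "('m \<Rightarrow> flag) \<Rightarrow> ('m \<Rightarrow> flag) \<Rightarrow> bool" where
  "config_rel F G \<longleftrightarrow> (\<exists>g. \<forall>i. G i = pgl_flag g (F i))"

text \<open>Tuples of flags are indexed by a type \<open>'m\<close>; for tetrahedra it is the numeral type \<open>4\<close>,
  with elements \<open>1, 2, 3, 4\<close> (and \<open>4 = 0\<close>).\<close>

quotient_type 'm configuration = "'m \<Rightarrow> flag" / config_rel
proof (rule equivpI)
  show "reflp (config_rel :: ('m \<Rightarrow> flag) \<Rightarrow> _)"
  proof (rule reflpI)
    fix F :: "'m \<Rightarrow> flag"
    obtain g where "\<forall>p. pgl_point g p = p" "\<forall>l. pgl_line g l = l" using pgl_id by blast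
    then show "config_rel F F"
      unfolding config_rel_def by (intro exI[of _ g] allI flag_eqI) simp_all
  qed
  show "symp (config_rel :: ('m \<Rightarrow> flag) \<Rightarrow> _)"
  proof (rule sympI)
    fix F G :: "'m \<Rightarrow> flag" assume "config_rel F G"
    then obtain g where g: "\<forall>i. G i = pgl_flag g (F i)" unfolding config_rel_def by blast
    obtain h where "\<forall>p. pgl_point h (pgl_point g p) = p" "\<forall>l. pgl_line h (pgl_line g l) = l"
      using pgl_inverse[of g] by blast
    with g show "config_rel G F"
      unfolding config_rel_def by (intro exI[of _ h] allI flag_eqI) simp_all
  qed
  show "transp (config_rel :: ('m \<Rightarrow> flag) \<Rightarrow> _)"
  proof (rule transpI)
    fix F G H :: "'m \<Rightarrow> flag" assume "config_rel F G" "config_rel G H"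
    then obtain g h where gh: "\<forall>i. G i = pgl_flag g (F i)" "\<forall>i. H i = pgl_flag h (G i)"
      unfolding config_rel_def by blast
    obtain k where "\<forall>p. pgl_point k p = pgl_point h (pgl_point g p)"
      "\<forall>l. pgl_line k l = pgl_line h (pgl_line g l)"
      using pgl_mult[of h g] by blast
    with gh show "config_rel F H"
      unfolding config_rel_def by (intro exI[of _ k] allI flag_eqI) simp_all
  qed
qed

lemma config_relE:
  assumes "config_rel F G"
  obtains g where "\<And>i. point_of (G i) = pgl_point g (point_of (F i))"
    "\<And>i. line_of (G i) = pgl_line g (line_of (F i))"
  using assms unfolding config_rel_def by force

lemma ex_pgl_line: "(\<exists>l. P l) \<longleftrightarrow> (\<exists>l. P (pgl_line g l))"
  using pgl_inverse[of g] by metis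

lemma ex_pgl_point: "(\<exists>p. P p) \<longleftrightarrow> (\<exists>p. P (pgl_point g p))"
  using pgl_inverse[of g] by metis

lift_definition generic :: "'m configuration \<Rightarrow> bool" is
  "\<lambda>F. (\<forall>i j. i \<noteq> j \<longrightarrow> \<not> incident (point_of (F j)) (line_of (F i))) \<and>
    (\<forall>i j k. distinct [i, j, k] \<longrightarrow> \<not> (\<exists>l. incident (point_of (F i)) l \<and>
      incident (point_of (F j)) l \<and> incident (point_of (F k)) l))"
proof (erule config_relE, goal_cases)
  case (1 F G g)
  show ?case
    unfolding 1 by (subst (2) ex_pgl_line[of _ g]) (simp only: incident_pgl)
qed

lift_definition no_three_lines_concurrent :: "'m configuration \<Rightarrow> bool" is
  "\<lambda>F. \<forall>i j k. distinct [i, j, k] \<longrightarrow> \<not> (\<exists>p. incident p (line_of (F i)) \<and>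
      incident p (line_of (F j)) \<and> incident p (line_of (F k)))"
proof (erule config_relE, goal_cases)
  case (1 F G g)
  show ?case
    unfolding 1 by (subst (2) ex_pgl_point[of _ g]) (simp only: incident_pgl)
qed

definition very_generic :: "'m configuration \<Rightarrow> bool" where
  "very_generic T \<longleftrightarrow> generic T \<and> no_three_lines_concurrent T"

lemma dual_pgl: "\<exists>h. (\<forall>p. pgl_point h p = pgl_line g p) \<and> (\<forall>l. pgl_line h l = pgl_point g l)"
proof (transfer, goal_cases)
  case (1 A)
  then have A: "invertible A" by (simp add: pgl_rel_refl)
  let ?B = "transpose (matrix_inv A)"
  have *: "?B ** transpose A = mat 1"
    by (metis A matrix_inv(1) matrix_transpose_mul transpose_mat)
  have B: "matrix_inv ?B = transpose A" using * by (rule matrix_inv_unique)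
  have "invertible ?B" using * invertible_right_inverse by blast
  then show ?case
    by (intro bexI[of _ ?B])
       (simp_all add: B A pgl_rel_refl proportional_refl_iff invertible_mult_nz)
qed

lift_definition dual_config :: "'m configuration \<Rightarrow> 'm configuration" is "\<lambda>F i. dual_flag (F i)"
proof (erule config_relE, goal_cases)
  case (1 F G g)
  obtain h where "\<forall>p. pgl_point h p = pgl_line g p" "\<forall>l. pgl_line h l = pgl_point g l"
    using dual_pgl by blast
  then show ?case
    unfolding config_rel_def by (intro exI[of _ h] allI flag_eqI) (simp_all add: 1)
qed


section \<open>Edge and face coordinates\<close>

text \<open>\<open>(1, 2, 3, 4) \<mapsto> (i, j, k, l)\<close> is an even permutation.\<close>

definition even_labelling :: "4 \<Rightarrow> 4 \<Rightarrow> 4 \<Rightarrow> 4 \<Rightarrow> bool" where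
  "even_labelling i j k l \<longleftrightarrow>
     (\<exists>\<sigma>. \<sigma> permutes UNIV \<and> evenperm \<sigma> \<and> \<sigma> 1 = i \<and> \<sigma> 2 = j \<and> \<sigma> 3 = k \<and> \<sigma> 4 = l)"

definition line_through :: "cp2 \<Rightarrow> cp2 \<Rightarrow> dual_cp2 \<Rightarrow> bool" where
  "line_through p q l \<longleftrightarrow> incident p l \<and> incident q l"

lemma proportional_pgl_line:
  assumes "invertible A"
  shows "proportional (f v* matrix_inv A) (f' v* matrix_inv A) \<longleftrightarrow> proportional f f'"
proof -
  have inj: "x v* matrix_inv A = y v* matrix_inv A \<longleftrightarrow> x = y" for x y :: "complex ^ 3"
    by (metis assms matrix_inv(2) vector_matrix_mul_assoc vector_matrix_mul_rid)
  show ?thesis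
    unfolding proportional_def
    by (simp only: invertible_mult_nz[OF assms] inj scalar_vector_matrix_assoc[symmetric])
qed

lemma affine_coord_pgl:
  "\<exists>\<phi>. bij \<phi> \<and> (\<forall>u v. lin_indep2 (\<phi> u) (\<phi> v) \<longleftrightarrow> lin_indep2 u v) \<and>
     (\<forall>u v l t. affine_coord (\<phi> u) (\<phi> v) (pgl_line g l) t \<longleftrightarrow> affine_coord u v l t)"
proof (transfer, goal_cases)
  case (1 A)
  then have A: "invertible A" by (simp add: pgl_rel_refl)
  let ?\<phi> = "\<lambda>u. u v* matrix_inv A"
  have "bij ?\<phi>"
    by (rule o_bij[of "\<lambda>u. u v* A"])
       (simp_all add: fun_eq_iff vector_matrix_mul_assoc matrix_inv[OF A])
  moreover have lin: "s *s ?\<phi> u + t *s ?\<phi> v = ?\<phi> (s *s u + t *s v)" for s t u v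
    by (simp add: vector_matrix_left_distrib scalar_vector_matrix_assoc)
  moreover have "t *s ?\<phi> u + ?\<phi> v = ?\<phi> (t *s u + v)" for t u v
    by (simp add: vector_matrix_left_distrib scalar_vector_matrix_assoc)
  ultimately show ?case
    by (intro exI[of _ ?\<phi>])
       (simp add: lin_indep2_def invertible_mult_nz[OF A] proportional_pgl_line[OF A])
qed

lemma cross_ratio_pgl:
  "cross_ratio (pgl_line g a) (pgl_line g b) (pgl_line g c) (pgl_line g d) = cross_ratio a b c d"
proof -
  obtain \<phi> where \<phi>: "bij \<phi>" "\<And>u v. lin_indep2 (\<phi> u) (\<phi> v) \<longleftrightarrow> lin_indep2 u v"
    "\<And>u v l t. affine_coord (\<phi> u) (\<phi> v) (pgl_line g l) t \<longleftrightarrow> affine_coord u v l t"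
    using affine_coord_pgl by metis
  have ex: "(\<exists>u. P u) \<longleftrightarrow> (\<exists>u. P (\<phi> u))" for P
    using \<phi>(1) by (metis bij_pointE)
  show ?thesis
    unfolding cross_ratio_def
    by (subst ex, subst (2) ex) (simp only: \<phi>)
qed

text \<open>
  For \<open>i \<noteq> j\<close> there is exactly one even labelling \<open>(i, j, k, l)\<close>; in a generic configuration the
  points are distinct, so \<open>p\<close>, \<open>q\<close>, \<open>r\<close> below are determined as the lines joining the \<open>i\<close>-th point to
  the \<open>j\<close>-th, \<open>k\<close>-th and \<open>l\<close>-th ones. The cross-ratio is taken in the pencil of lines through
  the \<open>i\<close>-th point, a projective line of the dual plane.
\<close>

lift_definition edge_coord :: "4 configuration \<Rightarrow> 4 \<Rightarrow> 4 \<Rightarrow> complex" is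
  "\<lambda>F i j. THE z. \<exists>k l p q r. even_labelling i j k l \<and>
     line_through (point_of (F i)) (point_of (F j)) p \<and>
     line_through (point_of (F i)) (point_of (F k)) q \<and>
     line_through (point_of (F i)) (point_of (F l)) r \<and>
     z = cross_ratio (line_of (F i)) p q r"
proof (erule config_relE, rule ext, rule ext)
  fix F G :: "4 \<Rightarrow> flag" and g i j
  assume 1: "\<And>i. point_of (G i) = pgl_point g (point_of (F i))"
    "\<And>i. line_of (G i) = pgl_line g (line_of (F i))"
  have ex: "(\<exists>p q r. P p q r) \<longleftrightarrow> (\<exists>p q r. P (pgl_line g p) (pgl_line g q) (pgl_line g r))" for P
    using pgl_inverse[of g] by metis
  show "(THE z. \<exists>k l p q r. even_labelling i j k l \<and>
       line_through (point_of (F i)) (point_of (F j)) p \<and>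
       line_through (point_of (F i)) (point_of (F k)) q \<and>
       line_through (point_of (F i)) (point_of (F l)) r \<and>
       z = cross_ratio (line_of (F i)) p q r) =
    (THE z. \<exists>k l p q r. even_labelling i j k l \<and>
       line_through (point_of (G i)) (point_of (G j)) p \<and>
       line_through (point_of (G i)) (point_of (G k)) q \<and>
       line_through (point_of (G i)) (point_of (G l)) r \<and>
       z = cross_ratio (line_of (G i)) p q r)"
    by (subst (2) ex) (simp only: 1 line_through_def incident_pgl cross_ratio_pgl)
qed

lift_definition triple_ratio ::
    "cp2 \<Rightarrow> dual_cp2 \<Rightarrow> cp2 \<Rightarrow> dual_cp2 \<Rightarrow> cp2 \<Rightarrow> dual_cp2 \<Rightarrow> complex" is
  "\<lambda>x\<^sub>1 f\<^sub>1 x\<^sub>2 f\<^sub>2 x\<^sub>3 f\<^sub>3.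
     (scalar_product f\<^sub>1 x\<^sub>2 * scalar_product f\<^sub>2 x\<^sub>3 * scalar_product f\<^sub>3 x\<^sub>1) /
     (scalar_product f\<^sub>1 x\<^sub>3 * scalar_product f\<^sub>2 x\<^sub>1 * scalar_product f\<^sub>3 x\<^sub>2)"
  by (auto simp: proportional_iff scalar_product_scale mult.assoc)

lemma triple_ratio_pgl:
  "triple_ratio (pgl_point g x\<^sub>1) (pgl_line g f\<^sub>1) (pgl_point g x\<^sub>2) (pgl_line g f\<^sub>2)
     (pgl_point g x\<^sub>3) (pgl_line g f\<^sub>3) = triple_ratio x\<^sub>1 f\<^sub>1 x\<^sub>2 f\<^sub>2 x\<^sub>3 f\<^sub>3"
  by transfer (simp add: scalar_product_pgl pgl_rel_refl)

lift_definition face_coord :: "'m configuration \<Rightarrow> 'm \<Rightarrow> 'm \<Rightarrow> 'm \<Rightarrow> complex" is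
  "\<lambda>F i j k. triple_ratio (point_of (F i)) (line_of (F i)) (point_of (F j)) (line_of (F j))
     (point_of (F k)) (line_of (F k))"
  by (erule config_relE) (simp only: triple_ratio_pgl)

end

theory Submission
  imports Defs
begin

text \<open>
  Write the flags as \<open>([x i], [f i])\<close> with vectors \<open>x i\<close> and covectors \<open>f i\<close>, put
  \<open>D i j k = det (x i, x j, x k)\<close>, and let \<open>D\<^sup>*\<close> be the same determinant for the \<open>f i\<close>.
  A pencil of lines is a projective line, and its cross-ratio in homogeneous coordinates gives
  \<open>z\<^sub>i\<^sub>j = f i (x k) D i j l / (f i (x l) D i j k)\<close> (\<open>edge_coord_lifts\<close>). Dualising exchanges
  \<open>x\<close> and \<open>f\<close>, so that \<open>z\<^sup>*\<^sub>i\<^sub>j\<close> is given by the same formula with \<open>D\<^sup>*\<close> in place of \<open>D\<close>, and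
  the triple ratio that defines a face coordinate turns into its inverse.

  What connects \<open>D\<^sup>*\<close> with \<open>D\<close> is the Gram matrix \<open>(f a (x b))\<close> on three indices \<open>i, j, k\<close>: its
  determinant is \<open>D\<^sup>* i j k D i j k\<close>, and its diagonal vanishes because a point lies on the line of
  its own flag. Only the two 3-cycles then contribute to the determinant. They are the numerator
  and the denominator of \<open>z\<^sub>i\<^sub>j\<^sub>k\<close>, so \<open>1 + z\<^sub>i\<^sub>j\<^sub>k\<close> is \<open>D\<^sup>* i j k D i j k\<close> over that denominator
  (\<open>one_plus_face_coord\<close>). The quotient of the two instances in the theorem therefore contains
  \<open>D\<^sup>* i j l / D\<^sup>* i j k\<close>, and the factor \<open>z\<^sub>j\<^sub>i\<close> turns the remaining terms into \<open>z\<^sup>*\<^sub>i\<^sub>j\<close>.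

  The version in terms of edge coordinates is the same formula, since the product of the three edge
  coordinates that end at a common vertex is minus a face coordinate of the opposite face
  (\<open>prod_edge_coord\<close>): all determinants cancel there, up to three signs.
\<close>


section \<open>Cross product and determinant over the complex numbers\<close>

definition cross_product :: "complex ^ 3 \<Rightarrow> complex ^ 3 \<Rightarrow> complex ^ 3" where
  "cross_product x y = vector
     [x $ 2 * y $ 3 - x $ 3 * y $ 2, x $ 3 * y $ 1 - x $ 1 * y $ 3, x $ 1 * y $ 2 - x $ 2 * y $ 1]"

text \<open>The determinant with columns \<open>x\<close>, \<open>y\<close>, \<open>z\<close>; up to scaling, \<open>cross_product x y\<close> is the line
  through \<open>[x]\<close> and \<open>[y]\<close>, and the bracket vanishes if \<open>[z]\<close> lies on it.\<close>

definition bracket :: "complex ^ 3 \<Rightarrow> complex ^ 3 \<Rightarrow> complex ^ 3 \<Rightarrow> complex" where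
  "bracket x y z = scalar_product (cross_product x y) z"

lemma scalar_product_3: "scalar_product f (x :: complex ^ 3) = f $ 1 * x $ 1 + f $ 2 * x $ 2 + f $ 3 * x $ 3"
  by (simp add: scalar_product_def sum_3)

lemmas coordinates = vec_eq_iff forall_3 cross_product_def bracket_def scalar_product_3

lemma bracket_swap:
  "bracket y x z = - bracket x y z" "bracket x z y = - bracket x y z"
  by (simp_all add: coordinates algebra_simps)

lemma cross_product_lincomb:
  "cross_product (a *s p + b *s q) (c *s p + d *s q) = (a * d - b * c) *s cross_product p q"
  by (simp add: coordinates algebra_simps)

lemma triple_product:
  "cross_product l (cross_product x y) = scalar_product l y *s x - scalar_product l x *s y"
  by (simp add: coordinates algebra_simps)

lemma scalar_product_cross_product [simp]:
  "scalar_product (cross_product x y) x = 0" "scalar_product (cross_product x y) y = 0"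
  by (simp_all add: coordinates algebra_simps)

text \<open>Cramer's rule for \<open>f\<close> in the basis of cross products, which is dual to \<open>x\<close>, \<open>y\<close>, \<open>z\<close> up to
  the determinant. With the next identity it expresses all lines through \<open>[x]\<close> in terms of the
  two lines that join it to \<open>[y]\<close> and \<open>[z]\<close>.\<close>

lemma cramer_cross_product:
  "bracket x y z *s f = scalar_product f x *s cross_product y z
     - scalar_product f y *s cross_product x z + scalar_product f z *s cross_product x y"
  by (simp add: coordinates algebra_simps)

lemma cramer_pencil:
  "bracket x y z *s cross_product x w =
     bracket x w z *s cross_product x y + bracket x y w *s cross_product x z"
  by (simp add: coordinates algebra_simps)

lemma proportional_iff_cross_product:
  assumes "x \<noteq> 0" "y \<noteq> 0"
  shows "proportional x y \<longleftrightarrow> cross_product x y = 0"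
proof
  assume "proportional x y"
  then show "cross_product x y = 0" by (auto simp: proportional_def coordinates)
next
  assume c: "cross_product x y = 0"
  obtain i where i: "x $ i \<noteq> 0" using assms by (auto simp: vec_eq_iff)
  have "x $ i * y $ j = y $ i * x $ j" for j
    using c exhaust_3[of i] exhaust_3[of j] by (auto simp: coordinates algebra_simps)
  then have "y = (y $ i / x $ i) *s x"
    using i by (simp add: vec_eq_iff field_simps)
  then show "proportional x y" using assms unfolding proportional_def by blast
qed

text \<open>The determinant of a product is the product of the determinants: the left factor has the
  covectors as rows, the right one the vectors as columns.\<close>

lemma gram_bracket:
  "bracket f g h * bracket x y z =
    scalar_product f x * (scalar_product g y * scalar_product h z - scalar_product g z * scalar_product h y)
    - scalar_product f y * (scalar_product g x * scalar_product h z - scalar_product g z * scalar_product h x)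
    + scalar_product f z * (scalar_product g x * scalar_product h y - scalar_product g y * scalar_product h x)"
  by (simp add: coordinates algebra_simps)

section \<open>Homogeneous coordinates of points and lines\<close>

lemma cp2_vector:
  obtains x where "x \<noteq> 0" "p = abs_cp2 x"
  by (metis Quotient_cp2 Quotient_abs_rep Quotient_rep_reflp proportional_refl_iff)

lemma abs_cp2_eq_iff:
  "x \<noteq> 0 \<Longrightarrow> y \<noteq> 0 \<Longrightarrow> abs_cp2 x = abs_cp2 y \<longleftrightarrow> proportional x y"
  by (metis Quotient_cp2 Quotient_rel proportional_refl)

lemma incident_abs:
  "x \<noteq> 0 \<Longrightarrow> f \<noteq> 0 \<Longrightarrow> incident (abs_cp2 x) (abs_cp2 f) \<longleftrightarrow> scalar_product f x = 0"
  by (rule incident.abs_eq) (simp_all add: proportional_refl)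

lemma affine_coord_abs:
  "x \<noteq> 0 \<Longrightarrow> affine_coord u v (abs_cp2 x) t \<longleftrightarrow> proportional x (t *s u + v)"
  by (simp add: affine_coord.abs_eq proportional_refl)

lemma triple_ratio_abs:
  assumes "x\<^sub>1 \<noteq> 0" "f\<^sub>1 \<noteq> 0" "x\<^sub>2 \<noteq> 0" "f\<^sub>2 \<noteq> 0" "x\<^sub>3 \<noteq> 0" "f\<^sub>3 \<noteq> 0"
  shows "triple_ratio (abs_cp2 x\<^sub>1) (abs_cp2 f\<^sub>1) (abs_cp2 x\<^sub>2) (abs_cp2 f\<^sub>2) (abs_cp2 x\<^sub>3) (abs_cp2 f\<^sub>3) =
     (scalar_product f\<^sub>1 x\<^sub>2 * scalar_product f\<^sub>2 x\<^sub>3 * scalar_product f\<^sub>3 x\<^sub>1) /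
     (scalar_product f\<^sub>1 x\<^sub>3 * scalar_product f\<^sub>2 x\<^sub>1 * scalar_product f\<^sub>3 x\<^sub>2)"
  using assms by (simp add: triple_ratio.abs_eq proportional_refl)

lemma line_through_iff:
  assumes "x \<noteq> 0" "y \<noteq> 0" "cross_product x y \<noteq> 0"
  shows "line_through (abs_cp2 x) (abs_cp2 y) l \<longleftrightarrow> l = abs_cp2 (cross_product x y)"
proof -
  obtain f where f: "f \<noteq> 0" "l = abs_cp2 f" by (rule cp2_vector)
  have "scalar_product f x = 0 \<and> scalar_product f y = 0 \<longleftrightarrow> proportional f (cross_product x y)"
  proof
    assume "proportional f (cross_product x y)"
    then obtain c where "f = c *s cross_product x y"
      using proportional_sym unfolding proportional_def by blast
    then show "scalar_product f x = 0 \<and> scalar_product f y = 0" by (simp add: scalar_product_scale)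
  qed (simp add: f assms proportional_iff_cross_product triple_product)
  then show ?thesis
    using assms f by (simp add: line_through_def incident_abs abs_cp2_eq_iff)
qed

section \<open>The cross-ratio in homogeneous coordinates\<close>

text \<open>
  Differences of affine coordinates are \<open>2 \<times> 2\<close> determinants of homogeneous ones up to factors that
  cancel in the cross-ratio: one for each of the four points, and one common factor for the change
  of basis from \<open>p\<close>, \<open>q\<close> to the chart. So all charts give the same value. A chart that contains
  the four points exists because only finitely many points of the line cannot be put at infinity.
\<close>

lemma cross_ratio_homogeneous:
  assumes pq: "cross_product p q \<noteq> 0"
    and ad: "a\<^sub>1 * d\<^sub>2 - a\<^sub>2 * d\<^sub>1 \<noteq> 0" and bc: "b\<^sub>1 * c\<^sub>2 - b\<^sub>2 * c\<^sub>1 \<noteq> 0"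
  shows "cross_ratio (abs_cp2 (a\<^sub>1 *s p + a\<^sub>2 *s q)) (abs_cp2 (b\<^sub>1 *s p + b\<^sub>2 *s q))
      (abs_cp2 (c\<^sub>1 *s p + c\<^sub>2 *s q)) (abs_cp2 (d\<^sub>1 *s p + d\<^sub>2 *s q)) =
    ((a\<^sub>1 * c\<^sub>2 - a\<^sub>2 * c\<^sub>1) * (b\<^sub>1 * d\<^sub>2 - b\<^sub>2 * d\<^sub>1)) / ((a\<^sub>1 * d\<^sub>2 - a\<^sub>2 * d\<^sub>1) * (b\<^sub>1 * c\<^sub>2 - b\<^sub>2 * c\<^sub>1))"
    (is "_ = ?X")
proof -
  define P where "P s t = s *s p + t *s q" for s t
  have cross_P: "cross_product (P s t) (P s' t') = (s * t' - t * s') *s cross_product p q" for s t s' t'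
    by (simp add: P_def cross_product_lincomb)
  have P_nz: "P s t \<noteq> 0" if "s \<noteq> 0 \<or> t \<noteq> 0" for s t
  proof
    assume "P s t = 0"
    then have "cross_product (P s t) (P 1 0) = 0" "cross_product (P s t) (P 0 1) = 0"
      by (simp_all add: coordinates)
    then show False using that pq by (auto simp: cross_P vec_eq_iff)
  qed
  have nz: "P a\<^sub>1 a\<^sub>2 \<noteq> 0" "P b\<^sub>1 b\<^sub>2 \<noteq> 0" "P c\<^sub>1 c\<^sub>2 \<noteq> 0" "P d\<^sub>1 d\<^sub>2 \<noteq> 0"
    using ad bc by (auto intro!: P_nz)
  have unique: "(a - c) * (b - d) / ((a - d) * (b - c)) = ?X"
    if chart: "proportional (P a\<^sub>1 a\<^sub>2) (a *s u + v)" "proportional (P b\<^sub>1 b\<^sub>2) (b *s u + v)"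
      "proportional (P c\<^sub>1 c\<^sub>2) (c *s u + v)" "proportional (P d\<^sub>1 d\<^sub>2) (d *s u + v)"
    for u v a b c d
  proof -
    obtain ka kb kc kd where k: "ka \<noteq> 0" "kb \<noteq> 0" "kc \<noteq> 0" "kd \<noteq> 0"
      "a *s u + v = ka *s P a\<^sub>1 a\<^sub>2" "b *s u + v = kb *s P b\<^sub>1 b\<^sub>2"
      "c *s u + v = kc *s P c\<^sub>1 c\<^sub>2" "d *s u + v = kd *s P d\<^sub>1 d\<^sub>2"
      using chart unfolding proportional_iff by blast
    have wedge: "(s - t) *s cross_product u v = (m * n * (s\<^sub>1 * t\<^sub>2 - s\<^sub>2 * t\<^sub>1)) *s cross_product p q"
      if "s *s u + v = m *s P s\<^sub>1 s\<^sub>2" "t *s u + v = n *s P t\<^sub>1 t\<^sub>2" for s t m n s\<^sub>1 s\<^sub>2 t\<^sub>1 t\<^sub>2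
    proof -
      have "(s - t) *s cross_product u v = cross_product (s *s u + v) (t *s u + v)"
        using cross_product_lincomb[of s u 1 v t 1] by simp
      also have "\<dots> = (m * n) *s cross_product (P s\<^sub>1 s\<^sub>2) (P t\<^sub>1 t\<^sub>2)"
        unfolding that by (simp add: coordinates algebra_simps)
      finally show ?thesis by (simp only: cross_P vector_smult_assoc)
    qed
    \<comment> \<open>The planes spanned by the chart and by the basis are compared through two distinct points
        that lie in both.\<close>
    have ad': "(a - d) *s cross_product u v = (ka * kd * (a\<^sub>1 * d\<^sub>2 - a\<^sub>2 * d\<^sub>1)) *s cross_product p q"
      using k by (intro wedge)
    have "a - d \<noteq> 0"
      using ad' k ad pq by auto
    then have "cross_product u v = (ka * kd * (a\<^sub>1 * d\<^sub>2 - a\<^sub>2 * d\<^sub>1) / (a - d)) *s cross_product p q"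
      using ad' by (simp add: vec_eq_iff field_simps)
    then obtain r where r: "cross_product u v = r *s cross_product p q" by blast
    have eq: "(s - t) * r = m * n * (s\<^sub>1 * t\<^sub>2 - s\<^sub>2 * t\<^sub>1)"
      if "s *s u + v = m *s P s\<^sub>1 s\<^sub>2" "t *s u + v = n *s P t\<^sub>1 t\<^sub>2" for s t m n s\<^sub>1 s\<^sub>2 t\<^sub>1 t\<^sub>2
      using wedge[OF that] pq unfolding r by (simp add: vector_smult_assoc)
    have "r \<noteq> 0" using eq[OF k(5,8)] k ad by auto
    have "(a - c) * (b - d) / ((a - d) * (b - c)) =
        (((a - c) * r) * ((b - d) * r)) / (((a - d) * r) * ((b - c) * r))"
      using \<open>r \<noteq> 0\<close> by simp
    also have "\<dots> = ?X"
      unfolding eq[OF k(5,7)] eq[OF k(6,8)] eq[OF k(5,8)] eq[OF k(6,7)]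
      using k by simp
    finally show ?thesis .
  qed
  \<comment> \<open>In the chart with \<open>P 1 t\<close> at infinity, any other point is finite.\<close>
  have chart: "proportional (P s\<^sub>1 s\<^sub>2) ((s\<^sub>1 / (s\<^sub>2 - t * s\<^sub>1)) *s P 1 t + P 0 1)"
    if "s\<^sub>2 \<noteq> t * s\<^sub>1" for t s\<^sub>1 s\<^sub>2
  proof -
    have "(s\<^sub>1 / (s\<^sub>2 - t * s\<^sub>1)) *s P 1 t + P 0 1 = (1 / (s\<^sub>2 - t * s\<^sub>1)) *s P s\<^sub>1 s\<^sub>2"
    proof -
      have coord: "s\<^sub>1 / (s\<^sub>2 - t * s\<^sub>1) * t + 1 = s\<^sub>2 / (s\<^sub>2 - t * s\<^sub>1)"
        using that by (simp add: divide_simps)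
      have lhs: "r *s P 1 t + P 0 1 = P r (r * t + 1)" for r
        by (simp add: P_def vec_eq_iff algebra_simps)
      have rhs: "r *s P s\<^sub>1 s\<^sub>2 = P (r * s\<^sub>1) (r * s\<^sub>2)" for r
        by (simp add: P_def vec_eq_iff algebra_simps)
      show ?thesis unfolding lhs rhs coord by simp
    qed
    moreover have "P s\<^sub>1 s\<^sub>2 \<noteq> 0" using that by (intro P_nz) auto
    moreover have "1 / (s\<^sub>2 - t * s\<^sub>1) \<noteq> 0" using that by simp
    ultimately show ?thesis unfolding proportional_iff by blast
  qed
  \<comment> \<open>A point with first coordinate 0 is not \<open>P 1 t\<close> for any \<open>t\<close>; division by zero makes it
      exclude \<open>t = 0\<close>, which is harmless.\<close>
  have "finite {a\<^sub>2 / a\<^sub>1, b\<^sub>2 / b\<^sub>1, c\<^sub>2 / c\<^sub>1, d\<^sub>2 / d\<^sub>1}" by simp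
  then obtain t where t: "t \<notin> {a\<^sub>2 / a\<^sub>1, b\<^sub>2 / b\<^sub>1, c\<^sub>2 / c\<^sub>1, d\<^sub>2 / d\<^sub>1}"
    using ex_new_if_finite[OF infinite_UNIV_char_0] by blast
  have "a\<^sub>2 \<noteq> t * a\<^sub>1" "b\<^sub>2 \<noteq> t * b\<^sub>1" "c\<^sub>2 \<noteq> t * c\<^sub>1" "d\<^sub>2 \<noteq> t * d\<^sub>1"
    using t ad bc by auto
  then have charts: "\<exists>u v a b c d. lin_indep2 u v \<and> proportional (P a\<^sub>1 a\<^sub>2) (a *s u + v) \<and>
      proportional (P b\<^sub>1 b\<^sub>2) (b *s u + v) \<and> proportional (P c\<^sub>1 c\<^sub>2) (c *s u + v) \<and>
      proportional (P d\<^sub>1 d\<^sub>2) (d *s u + v)"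
  proof -
    have "lin_indep2 (P 1 t) (P 0 1)"
      unfolding lin_indep2_def
    proof (intro allI impI)
      fix r s assume "r *s P 1 t + s *s P 0 1 = 0"
      moreover have "r *s P 1 t + s *s P 0 1 = P r (r * t + s)"
        by (simp add: P_def vec_eq_iff algebra_simps)
      ultimately have "r = 0 \<and> r * t + s = 0" using P_nz[of r "r * t + s"] by argo
      then show "r = 0 \<and> s = 0" by auto
    qed
    then show ?thesis
      using chart[OF \<open>a\<^sub>2 \<noteq> t * a\<^sub>1\<close>] chart[OF \<open>b\<^sub>2 \<noteq> t * b\<^sub>1\<close>]
        chart[OF \<open>c\<^sub>2 \<noteq> t * c\<^sub>1\<close>] chart[OF \<open>d\<^sub>2 \<noteq> t * d\<^sub>1\<close>] by blast
  qed
  show ?thesis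
    unfolding cross_ratio_def P_def[symmetric] affine_coord_abs[OF nz(1)] affine_coord_abs[OF nz(2)]
      affine_coord_abs[OF nz(3)] affine_coord_abs[OF nz(4)]
    using charts by (intro the_equality) (metis unique)+
qed

text \<open>
  In the basis of the lines joining \<open>[x]\<close> to \<open>[y]\<close> and \<open>[z]\<close>, the four members of the pencil have
  coordinates given by Cramer's rule. The determinant of \<open>f\<close> and the line to \<open>[w]\<close> is again
  a value of \<open>f\<close>, by expanding \<open>w\<close> in \<open>x\<close>, \<open>y\<close>, \<open>z\<close>.
\<close>

lemma cross_ratio_pencil:
  assumes "scalar_product f x = 0" "scalar_product f w \<noteq> 0" "bracket x y z \<noteq> 0"
  shows "cross_ratio (abs_cp2 f) (abs_cp2 (cross_product x y)) (abs_cp2 (cross_product x z))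
      (abs_cp2 (cross_product x w)) =
    (scalar_product f z * bracket x y w) / (scalar_product f w * bracket x y z)"
proof -
  let ?p = "cross_product x y" and ?q = "cross_product x z" and ?D = "bracket x y z"
  have scale: "v = (1 / ?D) *s (?D *s v)" for v
    using assms(3) by simp
  have f: "f = (scalar_product f z / ?D) *s ?p + (- scalar_product f y / ?D) *s ?q"
    using scale[of f] assms(1) unfolding cramer_cross_product[of x y z f]
    by (simp add: vec_eq_iff field_simps)
  have w: "cross_product x w = (bracket x w z / ?D) *s ?p + (bracket x y w / ?D) *s ?q"
    using scale[of "cross_product x w"] unfolding cramer_pencil[of x y z w]
    by (simp add: vec_eq_iff field_simps)
  have "cross_product ?p ?q = ?D *s x"
    by (simp add: coordinates algebra_simps)
  moreover have "x \<noteq> 0" using assms by (auto simp: coordinates)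
  ultimately have pq: "cross_product ?p ?q \<noteq> 0" using assms(3) by simp
  have fw: "scalar_product f w * ?D = scalar_product f z * bracket x y w + scalar_product f y * bracket x w z"
  proof -
    have "scalar_product f w * ?D = scalar_product f x * bracket y z w
        + scalar_product f z * bracket x y w + scalar_product f y * bracket x w z"
      by (simp add: coordinates algebra_simps)
    then show ?thesis using assms(1) by simp
  qed
  have ad: "scalar_product f z / ?D * (bracket x y w / ?D) - - scalar_product f y / ?D * (bracket x w z / ?D)
      = scalar_product f w / ?D" (is "?L = _")
  proof -
    have "?L = (scalar_product f w * ?D) / (?D * ?D)"
      unfolding fw by (simp add: add_divide_distrib)
    then show ?thesis using assms(3) by simp
  qed
  have "cross_ratio (abs_cp2 ((scalar_product f z / ?D) *s ?p + (- scalar_product f y / ?D) *s ?q))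
      (abs_cp2 (1 *s ?p + 0 *s ?q)) (abs_cp2 (0 *s ?p + 1 *s ?q))
      (abs_cp2 ((bracket x w z / ?D) *s ?p + (bracket x y w / ?D) *s ?q)) =
    (scalar_product f z / ?D * 1 - - scalar_product f y / ?D * 0) * (1 * (bracket x y w / ?D) - 0 * (bracket x w z / ?D)) /
    (scalar_product f w / ?D * (1 * 1 - 0 * 0))"
    unfolding ad[symmetric] using ad assms by (intro cross_ratio_homogeneous pq) simp_all
  then show ?thesis
    unfolding f[symmetric] w[symmetric] using assms by simp
qed

section \<open>Even labellings\<close>

lemma even_labelling_distinct: "even_labelling i j k l \<Longrightarrow> distinct [i, j, k, l]"
  unfolding even_labelling_def using permutes_inj[of _ "UNIV :: 4 set"]
  by (auto simp: inj_eq)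

text \<open>The labellings of the same parity as a given one arise by permuting the positions evenly.
  The witness \<open>\<sigma>\<close> names the entries of the given labelling, so that instances can be read off.\<close>

lemma even_labelling_compose:
  fixes \<tau> :: "4 \<Rightarrow> 4"
  assumes "even_labelling i j k l" "\<tau> permutes UNIV" "evenperm \<tau>"
  shows "\<exists>\<sigma>. even_labelling (\<sigma> (\<tau> 1)) (\<sigma> (\<tau> 2)) (\<sigma> (\<tau> 3)) (\<sigma> (\<tau> 4)) \<and>
    \<sigma> 1 = i \<and> \<sigma> 2 = j \<and> \<sigma> 3 = k \<and> \<sigma> 4 = l"
proof -
  obtain \<sigma> where \<sigma>: "\<sigma> permutes UNIV" "evenperm \<sigma>" "\<sigma> 1 = i" "\<sigma> 2 = j" "\<sigma> 3 = k" "\<sigma> 4 = l"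
    using assms(1) unfolding even_labelling_def by blast
  have "\<sigma> \<circ> \<tau> permutes UNIV" "evenperm (\<sigma> \<circ> \<tau>)"
    using \<sigma> assms permutation_permutes[of \<sigma>] permutation_permutes[of \<tau>]
    by (auto simp: permutes_compose evenperm_comp)
  then show ?thesis
    using \<sigma> unfolding even_labelling_def by (intro exI[of _ \<sigma>]) (auto intro!: exI[of _ "\<sigma> \<circ> \<tau>"])
qed

lemma evenperm_transpose_comp:
  fixes a b c d :: "'a :: finite"
  assumes "a \<noteq> b" "c \<noteq> d"
  shows "Transposition.transpose a b \<circ> Transposition.transpose c d permutes UNIV" "evenperm (Transposition.transpose a b \<circ> Transposition.transpose c d)"
  using assms by (auto simp: permutes_compose permutes_swap_id evenperm_comp evenperm_swap permutation_swap_id)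

text \<open>These two rearrangements generate the alternating group on the four positions, so all the even
  labellings needed below follow from them.\<close>

lemma even_labelling_swaps: "even_labelling i j k l \<Longrightarrow> even_labelling j i l k"
  using even_labelling_compose[OF _ evenperm_transpose_comp[of 1 2 3 4], of i j k l]
  by (auto simp: Transposition.transpose_def)

lemma even_labelling_rotate: "even_labelling i j k l \<Longrightarrow> even_labelling i k l j"
  using even_labelling_compose[OF _ evenperm_transpose_comp[of 2 3 3 4], of i j k l]
  by (auto simp: Transposition.transpose_def)

text \<open>Two labellings that agree in the first two entries can only differ by exchanging the others,
  which is an odd permutation.\<close>

lemma even_labelling_unique:
  assumes "even_labelling i j k l" "even_labelling i j k' l'"
  shows "k' = k" "l' = l"
proof -
  obtain \<sigma> where \<sigma>: "\<sigma> permutes UNIV" "evenperm \<sigma>" "\<sigma> 1 = i" "\<sigma> 2 = j" "\<sigma> 3 = k" "\<sigma> 4 = l"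
    using assms(1) unfolding even_labelling_def by blast
  obtain \<sigma>' where \<sigma>': "\<sigma>' permutes UNIV" "evenperm \<sigma>'" "\<sigma>' 1 = i" "\<sigma>' 2 = j" "\<sigma>' 3 = k'" "\<sigma>' 4 = l'"
    using assms(2) unfolding even_labelling_def by blast
  have kl: "m = k \<or> m = l" if "m \<noteq> i" "m \<noteq> j" for m
  proof -
    obtain n where "m = \<sigma> n" using permutes_surj[OF \<sigma>(1)] by (metis surjD)
    then show ?thesis using that \<sigma> exhaust_4[of n] by auto
  qed
  have "k' = k \<and> l' = l \<or> k' = l \<and> l' = k"
    using even_labelling_distinct[OF assms(2)] kl[of k'] kl[of l'] by auto
  moreover have False if "k' = l" "l' = k"
  proof -
    have "\<sigma>' m = (\<sigma> \<circ> Transposition.transpose 3 4) m" for m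
      using \<sigma> \<sigma>' that exhaust_4[of m] by (auto simp: Transposition.transpose_def)
    then have "\<sigma>' = \<sigma> \<circ> Transposition.transpose 3 4" by blast
    then show False
      using \<sigma> \<sigma>' permutation_permutes[of \<sigma>]
      by (auto simp: evenperm_comp evenperm_swap permutation_swap_id)
  qed
  ultimately show "k' = k" "l' = l" by blast+
qed

section \<open>Coordinates of lifted configurations\<close>

text \<open>Only defined up to scaling each \<open>x i\<close> and \<open>f i\<close> and up to the projective action, so a
  relation; all formulas below hold for every choice.\<close>

definition lifts :: "'m configuration \<Rightarrow> ('m \<Rightarrow> complex ^ 3) \<Rightarrow> ('m \<Rightarrow> complex ^ 3) \<Rightarrow> bool" where
  "lifts T x f \<longleftrightarrow> (\<forall>i. x i \<noteq> 0 \<and> f i \<noteq> 0) \<and>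
     (\<exists>F. T = abs_configuration F \<and>
       (\<forall>i. point_of (F i) = abs_cp2 (x i) \<and> line_of (F i) = abs_cp2 (f i)))"

lemma lifts_exist:
  obtains x f where "lifts T x f"
proof -
  obtain F where F: "T = abs_configuration F"
    by (metis Quotient_configuration Quotient_abs_rep)
  have "\<forall>i. \<exists>x. x \<noteq> 0 \<and> point_of (F i) = abs_cp2 x" "\<forall>i. \<exists>f. f \<noteq> 0 \<and> line_of (F i) = abs_cp2 f"
    by (metis cp2_vector)+
  then show thesis
    using that F unfolding lifts_def by metis
qed

text \<open>Duality is the exchange of vectors and covectors, so every formula below also gives one for
  the dual configuration.\<close>

lemma lifts_dual: "lifts T x f \<Longrightarrow> lifts (dual_config T) f x"
  unfolding lifts_def by (force simp: dual_config.abs_eq)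

context
  fixes T :: "'m configuration" and x f
  assumes T: "lifts T x f"
begin

lemma lifts_incident: "scalar_product (f i) (x i) = 0"
  using T incident_flag unfolding lifts_def by (metis incident_abs)

lemma generic_lifts_pairing: "generic T \<Longrightarrow> i \<noteq> j \<Longrightarrow> scalar_product (f i) (x j) \<noteq> 0"
  using T unfolding lifts_def by (auto simp: generic.abs_eq incident_abs)

text \<open>Two points coincide only if every line contains both or neither, but the line of the
  \<open>i\<close>-th flag separates them.\<close>

lemma generic_lifts_cross_product:
  assumes "generic T" "i \<noteq> j"
  shows "cross_product (x i) (x j) \<noteq> 0"
proof
  assume "cross_product (x i) (x j) = 0"
  then have "scalar_product (f i) (x j) *s x i - scalar_product (f i) (x i) *s x j = 0"
    by (simp flip: triple_product) (simp add: coordinates)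
  then show False
    using T generic_lifts_pairing[OF assms] by (simp add: lifts_incident lifts_def)
qed

lemma generic_lifts_bracket:
  assumes "generic T" "distinct [i, j, k]"
  shows "bracket (x i) (x j) (x k) \<noteq> 0"
proof
  let ?l = "cross_product (x i) (x j)"
  assume "bracket (x i) (x j) (x k) = 0"
  moreover have "?l \<noteq> 0" using assms by (intro generic_lifts_cross_product) auto
  moreover obtain F where F: "T = abs_configuration F" "\<And>i. point_of (F i) = abs_cp2 (x i)" "\<And>i. x i \<noteq> 0"
    using T unfolding lifts_def by blast
  ultimately have "incident (point_of (F i)) (abs_cp2 ?l) \<and> incident (point_of (F j)) (abs_cp2 ?l) \<and>
      incident (point_of (F k)) (abs_cp2 ?l)"
    by (simp add: incident_abs bracket_def)
  then show False
    using assms unfolding F(1) generic.abs_eq by blast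
qed

lemma face_coord_lifts: "face_coord T i j k =
  (scalar_product (f i) (x j) * scalar_product (f j) (x k) * scalar_product (f k) (x i)) /
  (scalar_product (f i) (x k) * scalar_product (f j) (x i) * scalar_product (f k) (x j))"
  using T unfolding lifts_def by (auto simp: face_coord.abs_eq triple_ratio_abs)

end

text \<open>Concurrence of the lines is collinearity of the points of the dual flags: this is where very
  genericity enters.\<close>

lemma generic_dual: "very_generic T \<Longrightarrow> generic (dual_config T)"
  unfolding very_generic_def
proof (induction T)
  case (1 F)
  then show ?case
    by (auto simp: dual_config.abs_eq generic.abs_eq no_three_lines_concurrent.abs_eq incident_commute)
qed

lemma edge_coord_lifts:
  assumes T: "lifts T x f" and "generic T" and ijkl: "even_labelling i j k l"
  shows "edge_coord T i j =
    (scalar_product (f i) (x k) * bracket (x i) (x j) (x l)) /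
    (scalar_product (f i) (x l) * bracket (x i) (x j) (x k))"
proof -
  obtain F where F: "T = abs_configuration F" "\<And>i. point_of (F i) = abs_cp2 (x i)"
      "\<And>i. line_of (F i) = abs_cp2 (f i)" "\<And>i. x i \<noteq> 0"
    using T unfolding lifts_def by blast
  have d: "distinct [i, j, k, l]" using ijkl by (rule even_labelling_distinct)
  have line: "line_through (abs_cp2 (x i)) (abs_cp2 (x m)) p \<longleftrightarrow> p = abs_cp2 (cross_product (x i) (x m))"
    if "i \<noteq> m" for m p
    using F line_through_iff generic_lifts_cross_product[OF T \<open>generic T\<close> that] by simp
  have "edge_coord T i j = cross_ratio (abs_cp2 (f i)) (abs_cp2 (cross_product (x i) (x j)))
      (abs_cp2 (cross_product (x i) (x k))) (abs_cp2 (cross_product (x i) (x l)))"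
    unfolding F(1) edge_coord.abs_eq
  proof (rule the_equality, goal_cases)
    case 1
    show ?case using ijkl d by (intro exI conjI) (auto simp: line F)
  next
    case (2 z)
    then show ?case using even_labelling_unique[OF ijkl] d by (auto simp: line F)
  qed
  also have "\<dots> = (scalar_product (f i) (x k) * bracket (x i) (x j) (x l)) /
      (scalar_product (f i) (x l) * bracket (x i) (x j) (x k))"
    using d generic_lifts_pairing[OF T \<open>generic T\<close>] generic_lifts_bracket[OF T \<open>generic T\<close>]
    by (intro cross_ratio_pencil) (auto simp: lifts_incident[OF T])
  finally show ?thesis .
qed

text \<open>Each determinant occurs once in a numerator and once, with odd reordering, in a denominator;
  the three signs leave \<open>-1\<close>.\<close>

lemma prod_edge_coord:
  assumes T: "lifts T x f" and g: "generic T" and e: "even_labelling i j k l"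
  shows "edge_coord T i k * edge_coord T j k * edge_coord T l k = - face_coord T j i l"
proof -
  have d: "distinct [i, j, k, l]" using e by (rule even_labelling_distinct)
  have e': "even_labelling i k l j" "even_labelling j k i l" "even_labelling l k j i"
  proof -
    note rot = even_labelling_rotate and sw = even_labelling_swaps
    show "even_labelling i k l j" by (rule rot[OF e])
    show "even_labelling j k i l" by (rule rot[OF rot[OF sw[OF e]]])
    show "even_labelling l k j i" by (rule rot[OF sw[OF rot[OF rot[OF e]]]])
  qed
  have nz: "bracket (x i) (x j) (x k) \<noteq> 0" "bracket (x i) (x k) (x l) \<noteq> 0" "bracket (x j) (x k) (x l) \<noteq> 0"
    using d generic_lifts_bracket[OF T g] by auto
  have b: "bracket (x i) (x k) (x j) = - bracket (x i) (x j) (x k)"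
    "bracket (x j) (x k) (x i) = bracket (x i) (x j) (x k)"
    "bracket (x l) (x k) (x i) = - bracket (x i) (x k) (x l)"
    "bracket (x l) (x k) (x j) = - bracket (x j) (x k) (x l)"
    by (simp_all add: coordinates algebra_simps)
  show ?thesis
    unfolding face_coord_lifts[OF T] edge_coord_lifts[OF T g e'(1)]
      edge_coord_lifts[OF T g e'(2)] edge_coord_lifts[OF T g e'(3)] b
    using nz by (simp add: divide_simps)
qed

text \<open>The Gram determinant of the face has zero diagonal, so it is the sum of its two 3-cycles.\<close>

lemma one_plus_face_coord:
  assumes T: "lifts T x f" and g: "generic T" and d: "distinct [i, j, k]"
  shows "1 + face_coord T i j k = bracket (f i) (f j) (f k) * bracket (x i) (x j) (x k) /
     (scalar_product (f i) (x k) * scalar_product (f j) (x i) * scalar_product (f k) (x j))"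
  unfolding face_coord_lifts[OF T] gram_bracket lifts_incident[OF T]
proof -
  have "scalar_product (f i) (x k) \<noteq> 0" "scalar_product (f j) (x i) \<noteq> 0" "scalar_product (f k) (x j) \<noteq> 0"
    using d generic_lifts_pairing[OF T g] by auto
  then show "1 + scalar_product (f i) (x j) * scalar_product (f j) (x k) * scalar_product (f k) (x i) /
      (scalar_product (f i) (x k) * scalar_product (f j) (x i) * scalar_product (f k) (x j)) =
    (0 * (0 * 0 - scalar_product (f j) (x k) * scalar_product (f k) (x j))
     - scalar_product (f i) (x j) * (scalar_product (f j) (x i) * 0 - scalar_product (f j) (x k) * scalar_product (f k) (x i))
     + scalar_product (f i) (x k) * (scalar_product (f j) (x i) * scalar_product (f k) (x j) - 0 * scalar_product (f k) (x i))) /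
    (scalar_product (f i) (x k) * scalar_product (f j) (x i) * scalar_product (f k) (x j))"
    by (simp add: field_simps)
qed


section \<open>Coordinates of the dual configuration\<close>

theorem proposition3p3:
  fixes T :: "4 configuration"
  assumes "very_generic T"
  shows "(\<forall>i j k. distinct [i, j, k] \<longrightarrow>
      face_coord (dual_config T) i j k = 1 / face_coord T i j k) \<and>
    (\<forall>i j k l. even_labelling i j k l \<longrightarrow>
      edge_coord (dual_config T) i j =
        edge_coord T j i * ((1 - edge_coord T i k * edge_coord T j k * edge_coord T l k) /
          (1 - 1 / (edge_coord T i l * edge_coord T j l * edge_coord T k l))) \<and>
      edge_coord T j i * ((1 - edge_coord T i k * edge_coord T j k * edge_coord T l k) /
          (1 - 1 / (edge_coord T i l * edge_coord T j l * edge_coord T k l))) =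
        edge_coord T j i * ((1 + face_coord T j i l) / (1 + 1 / face_coord T i j k)))"
proof -
  obtain x f where T: "lifts T x f" by (rule lifts_exist)
  have g: "generic T" using assms by (simp add: very_generic_def)
  note T' = lifts_dual[OF T] and g' = generic_dual[OF assms]
  have face: "face_coord (dual_config T) i j k = 1 / face_coord T i j k" for i j k
    unfolding face_coord_lifts[OF T] face_coord_lifts[OF T'] by (simp add: scalar_product_commute mult_ac)
  have edge: "edge_coord (dual_config T) i j =
      edge_coord T j i * ((1 + face_coord T j i l) / (1 + 1 / face_coord T i j k))"
    and prod: "edge_coord T i k * edge_coord T j k * edge_coord T l k = - face_coord T j i l"
      "edge_coord T i l * edge_coord T j l * edge_coord T k l = - face_coord T i j k"
    if e: "even_labelling i j k l" for i j k l
  proof -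
    have d: "distinct [i, j, k, l]" using e by (rule even_labelling_distinct)
    show "edge_coord T i k * edge_coord T j k * edge_coord T l k = - face_coord T j i l"
      by (rule prod_edge_coord[OF T g e])
    show "edge_coord T i l * edge_coord T j l * edge_coord T k l = - face_coord T i j k"
      using prod_edge_coord[OF T g even_labelling_swaps[OF e]] by (simp add: mult_ac)
    have nz: "bracket (f i) (f j) (f k) \<noteq> 0" "bracket (x i) (x j) (x k) \<noteq> 0" "bracket (x i) (x j) (x l) \<noteq> 0"
      using d generic_lifts_bracket[OF T' g'] generic_lifts_bracket[OF T g] by auto
    \<comment> \<open>Inverting a triple ratio reverses the orientation of the face, so both factors \<open>1 + z\<close> are
        Gram determinants.\<close>
    have inv: "1 / face_coord T i j k = face_coord T i k j"
      unfolding face_coord_lifts[OF T] by (simp add: mult_ac)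
    have d': "distinct [j, i, l]" "distinct [i, k, j]" using d by auto
    show "edge_coord (dual_config T) i j =
      edge_coord T j i * ((1 + face_coord T j i l) / (1 + 1 / face_coord T i j k))"
      unfolding edge_coord_lifts[OF T' g' e] edge_coord_lifts[OF T g even_labelling_swaps[OF e]] inv
        one_plus_face_coord[OF T g d'(1)] one_plus_face_coord[OF T g d'(2)]
        bracket_swap(1)[of "x j"] bracket_swap(1)[of "f j"] bracket_swap(2)[of "x i" "x k"] bracket_swap(2)[of "f i" "f k"]
      using d nz generic_lifts_pairing[OF T g] by (simp add: scalar_product_commute[of "x _"] divide_simps)
  qed
  show ?thesis
  proof (intro conjI allI impI, goal_cases)
    case (1 i j k)
    show ?case by (rule face)
  next
    case (2 i j k l)
    then show ?case by (simp add: edge[OF 2] prod[OF 2])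
  next
    case (3 i j k l)
    then show ?case by (simp add: prod[OF 3])
  qed
qed

end
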